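(* Let $L$ be a first-order language, $D$ a new $r$-ary predicate symbol, and let $\phi(a_1,\ldots,a_r)$ be the formula $$(\exists x_1\cdots x_n)(a_1=t_1\wedge\cdots\wedge a_r=t_r\wedge A_1\wedge\cdots\wedge A_m),$$ where $t_1,\ldots,t_r$ are $L$-terms and $A_1,\ldots,A_m$ are $L$-atoms whose variables are all among $x_1,\ldots,x_n$. Then for any formula $\psi$ of the language $L\cup\{D\}$, $$\mathrm{LK}_\mathrm{e}^\mathrm{fcs}(D)\vdash\psi\quad\text{if and only if}\quad \mathrm{LK}_\mathrm{e}(D)\vdash\psi.$$
   Context: $\mathrm{LK}_\mathrm{e}$ is the standard sequent calculus (including cut) for first-order predicate logic with equality over the language $L$. A calculus proves a formula $\psi$ ($\vdash\psi$) if it derives the sequent $\rightarrow\psi$. Below, $a_1,\ldots,a_r$ are arbitrary terms (bound variables of $\phi$ being renamed as needed to avoid capture), $\underline{x}=(x_1,\ldots,x_n)$, and $[\underline{x}\backslash\underline{s}]$ denotes simultaneous substitution. $\mathrm{LK}_\mathrm{e}(D)$ is the calculus obtained from $\mathrm{LK}_\mathrm{e}$, now used over the enlarged language $L\cup\{D\}$, by adding the two rules: ($D_\mathrm{L}$) from $\phi(a_1,\ldots,a_r),\Gamma\rightarrow\Delta$ infer $D(a_1,\ldots,a_r),\Gamma\rightarrow\Delta$; ($D_\mathrm{R}$) from $\Gamma\rightarrow\Delta,\phi(a_1,\ldots,a_r)$ infer $\Gamma\rightarrow\Delta,D(a_1,\ldots,a_r)$. $\mathrm{LK}_\mathrm{e}^\mathrm{fcs}(D)$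 is the calculus obtained from $\mathrm{LK}_\mathrm{e}$, used over $L\cup\{D\}$, by adding instead the following two rules. Rule $D^\mathrm{fcs}_\mathrm{L}$: from $$a_1=t_1[\underline{x}\backslash\underline{\zeta}],\ldots,a_r=t_r[\underline{x}\backslash\underline{\zeta}],A_1[\underline{x}\backslash\underline{\zeta}],\ldots,A_m[\underline{x}\backslash\underline{\zeta}],\Gamma\rightarrow\Delta$$ infer $D(a_1,\ldots,a_r),\Gamma\rightarrow\Delta$, where $\underline{\zeta}=(\zeta_1,\ldots,\zeta_n)$ are pairwise distinct eigenvariables, i.e. variables not occurring free in the conclusion. Rule $D^\mathrm{fcs}_\mathrm{R}$: from the $m$ premises $\Gamma\rightarrow\Delta,A_1[\underline{x}\backslash\underline{u}]$, $\ldots$, $\Gamma\rightarrow\Delta,A_m[\underline{x}\backslash\underline{u}]$ infer $$\Gamma\rightarrow\Delta,D(t_1[\underline{x}\backslash\underline{u}],\ldots,t_r[\underline{x}\backslash\underline{u}]),$$ where $\underline{u}=(u_1,\ldots,u_n)$ are arbitrary terms. *)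

theory Defs
  imports "HOL-Library.Multiset"
begin

section \<open>First-order languages, terms and formulas with equality\<close>

text \<open>
  Arities are partial, so that a language may lack function symbols or predicate symbols
  altogether even though types are nonempty.
\<close>

record ('f, 'p) language =
  fun_arity :: "'f \<rightharpoonup> nat"
  pred_arity :: "'p \<rightharpoonup> nat"

definition add_pred :: "('f, 'p) language \<Rightarrow> 'p \<Rightarrow> nat \<Rightarrow> ('f, 'p) language" where
  "add_pred L D r = L\<lparr>pred_arity := (pred_arity L)(D \<mapsto> r)\<rparr>"

text \<open>
  Bound variables are de Bruijn indices, so formulas are identified up to renaming of bound
  variables and substitution is capture-avoiding. The free variables are the natural numbers: under
  \<open>k\<close> quantifiers, the index \<open>i \<ge> k\<close> denotes the free variable \<open>i - k\<close>.
\<close>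

datatype 'f tm = Var nat | Fun 'f "'f tm list"

datatype ('f, 'p) fm =
    Eq "'f tm" "'f tm"
  | Pred 'p "'f tm list"
  | Neg "('f, 'p) fm"
  | Conj "('f, 'p) fm" "('f, 'p) fm"
  | Disj "('f, 'p) fm" "('f, 'p) fm"
  | Impl "('f, 'p) fm" "('f, 'p) fm"
  | Forall "('f, 'p) fm"
  | Exists "('f, 'p) fm"

fun is_atom :: "('f, 'p) fm \<Rightarrow> bool" where
  "is_atom (Eq s t) = True"
| "is_atom (Pred p ts) = True"
| "is_atom _ = False"

fun wf_tm :: "('f, 'p) language \<Rightarrow> 'f tm \<Rightarrow> bool" where
  "wf_tm L (Var v) = True"
| "wf_tm L (Fun f ts) = (fun_arity L f = Some (length ts) \<and> (\<forall>t\<in>set ts. wf_tm L t))"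

primrec wf_fm :: "('f, 'p) language \<Rightarrow> ('f, 'p) fm \<Rightarrow> bool" where
  "wf_fm L (Eq s t) = (wf_tm L s \<and> wf_tm L t)"
| "wf_fm L (Pred p ts) = (pred_arity L p = Some (length ts) \<and> (\<forall>t\<in>set ts. wf_tm L t))"
| "wf_fm L (Neg F) = wf_fm L F"
| "wf_fm L (Conj F G) = (wf_fm L F \<and> wf_fm L G)"
| "wf_fm L (Disj F G) = (wf_fm L F \<and> wf_fm L G)"
| "wf_fm L (Impl F G) = (wf_fm L F \<and> wf_fm L G)"
| "wf_fm L (Forall F) = wf_fm L F"
| "wf_fm L (Exists F) = wf_fm L F"

fun fv_tm :: "'f tm \<Rightarrow> nat set" where
  "fv_tm (Var v) = {v}"
| "fv_tm (Fun f ts) = (\<Union>t\<in>set ts. fv_tm t)"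

primrec fv_fm :: "('f, 'p) fm \<Rightarrow> nat set" where
  "fv_fm (Eq s t) = fv_tm s \<union> fv_tm t"
| "fv_fm (Pred p ts) = (\<Union>t\<in>set ts. fv_tm t)"
| "fv_fm (Neg F) = fv_fm F"
| "fv_fm (Conj F G) = fv_fm F \<union> fv_fm G"
| "fv_fm (Disj F G) = fv_fm F \<union> fv_fm G"
| "fv_fm (Impl F G) = fv_fm F \<union> fv_fm G"
| "fv_fm (Forall F) = {v. Suc v \<in> fv_fm F}"
| "fv_fm (Exists F) = {v. Suc v \<in> fv_fm F}"


subsection \<open>Substitution\<close>

fun subst_tm :: "(nat \<Rightarrow> 'f tm) \<Rightarrow> 'f tm \<Rightarrow> 'f tm" where
  "subst_tm \<sigma> (Var v) = \<sigma> v"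
| "subst_tm \<sigma> (Fun f ts) = Fun f (map (subst_tm \<sigma>) ts)"

definition lift_tm :: "nat \<Rightarrow> 'f tm \<Rightarrow> 'f tm" where
  "lift_tm k t = subst_tm (\<lambda>v. Var (v + k)) t"

definition under_binder :: "(nat \<Rightarrow> 'f tm) \<Rightarrow> nat \<Rightarrow> 'f tm" where
  "under_binder \<sigma> = case_nat (Var 0) (\<lambda>v. lift_tm 1 (\<sigma> v))"

primrec subst_fm :: "(nat \<Rightarrow> 'f tm) \<Rightarrow> ('f, 'p) fm \<Rightarrow> ('f, 'p) fm" where
  "subst_fm \<sigma> (Eq s t) = Eq (subst_tm \<sigma> s) (subst_tm \<sigma> t)"
| "subst_fm \<sigma> (Pred p ts) = Pred p (map (subst_tm \<sigma>) ts)"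
| "subst_fm \<sigma> (Neg F) = Neg (subst_fm \<sigma> F)"
| "subst_fm \<sigma> (Conj F G) = Conj (subst_fm \<sigma> F) (subst_fm \<sigma> G)"
| "subst_fm \<sigma> (Disj F G) = Disj (subst_fm \<sigma> F) (subst_fm \<sigma> G)"
| "subst_fm \<sigma> (Impl F G) = Impl (subst_fm \<sigma> F) (subst_fm \<sigma> G)"
| "subst_fm \<sigma> (Forall F) = Forall (subst_fm (under_binder \<sigma>) F)"
| "subst_fm \<sigma> (Exists F) = Exists (subst_fm (under_binder \<sigma>) F)"

text \<open>
  If \<open>F\<close> is the body of a quantified formula, \<open>inst F t\<close> replaces the variable bound by that
  quantifier by \<open>t\<close>.
\<close>

definition inst :: "('f, 'p) fm \<Rightarrow> 'f tm \<Rightarrow> ('f, 'p) fm" where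
  "inst F t = subst_fm (case_nat t Var) F"

text \<open>The simultaneous substitution of the terms \<open>us\<close> for the pairwise distinct variables \<open>xs\<close>.\<close>

definition simsub :: "nat list \<Rightarrow> 'f tm list \<Rightarrow> nat \<Rightarrow> 'f tm" where
  "simsub xs us v = (case map_of (zip xs us) v of None \<Rightarrow> Var v | Some u \<Rightarrow> u)"


section \<open>The sequent calculus with equality\<close>

text \<open>
  Sequents are pairs of finite multisets, which makes the exchange rules implicit; weakening,
  contraction and cut are explicit rules.
\<close>

datatype ('f, 'p) sequent =
  Sequent "('f, 'p) fm multiset" "('f, 'p) fm multiset"  (infix \<open>\<tturnstile>\<close> 50)

fun fv_sequent :: "('f, 'p) sequent \<Rightarrow> nat set" where
  "fv_sequent (\<Gamma> \<tturnstile> \<Delta>) = (\<Union>F\<in>set_mset (\<Gamma> + \<Delta>). fv_fm F)"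

fun wf_sequent :: "('f, 'p) language \<Rightarrow> ('f, 'p) sequent \<Rightarrow> bool" where
  "wf_sequent L (\<Gamma> \<tturnstile> \<Delta>) = (\<forall>F\<in>set_mset (\<Gamma> + \<Delta>). wf_fm L F)"

text \<open>
  \<open>LKe_rule L ps c\<close>: the sequent \<open>c\<close> is inferred from the list \<open>ps\<close> of premises. That the sequents
  belong to the language is imposed once and for all in \<open>derivable\<close> below. The last four axioms are
  the equality axioms; substitutivity is thus available for every predicate symbol of \<open>L\<close>.
\<close>

inductive LKe_rule ::
  "('f, 'p) language \<Rightarrow> ('f, 'p) sequent list \<Rightarrow> ('f, 'p) sequent \<Rightarrow> bool"
  for L :: "('f, 'p) language" where
  Ax: "LKe_rule L [] ({#F#} \<tturnstile> {#F#})"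
| EqRefl: "LKe_rule L [] ({#} \<tturnstile> {#Eq s s#})"
| EqFun: "length ss = length ts \<Longrightarrow>
    LKe_rule L [] (mset (map2 Eq ss ts) \<tturnstile> {#Eq (Fun f ss) (Fun f ts)#})"
| EqPred: "length ss = length ts \<Longrightarrow>
    LKe_rule L [] (mset (map2 Eq ss ts) + {#Pred p ss#} \<tturnstile> {#Pred p ts#})"
| EqEq: "LKe_rule L [] ({#Eq s\<^sub>1 t\<^sub>1, Eq s\<^sub>2 t\<^sub>2, Eq s\<^sub>1 s\<^sub>2#} \<tturnstile> {#Eq t\<^sub>1 t\<^sub>2#})"
| WeakL: "LKe_rule L [\<Gamma> \<tturnstile> \<Delta>] (add_mset F \<Gamma> \<tturnstile> \<Delta>)"
| WeakR: "LKe_rule L [\<Gamma> \<tturnstile> \<Delta>] (\<Gamma> \<tturnstile> add_mset F \<Delta>)"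
| ContrL: "LKe_rule L [add_mset F (add_mset F \<Gamma>) \<tturnstile> \<Delta>] (add_mset F \<Gamma> \<tturnstile> \<Delta>)"
| ContrR: "LKe_rule L [\<Gamma> \<tturnstile> add_mset F (add_mset F \<Delta>)] (\<Gamma> \<tturnstile> add_mset F \<Delta>)"
| Cut: "LKe_rule L [\<Gamma> \<tturnstile> add_mset F \<Delta>, add_mset F \<Pi> \<tturnstile> \<Lambda>] (\<Gamma> + \<Pi> \<tturnstile> \<Delta> + \<Lambda>)"
| NegL: "LKe_rule L [\<Gamma> \<tturnstile> add_mset F \<Delta>] (add_mset (Neg F) \<Gamma> \<tturnstile> \<Delta>)"
| NegR: "LKe_rule L [add_mset F \<Gamma> \<tturnstile> \<Delta>] (\<Gamma> \<tturnstile> add_mset (Neg F) \<Delta>)"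
| ConjL1: "LKe_rule L [add_mset F \<Gamma> \<tturnstile> \<Delta>] (add_mset (Conj F G) \<Gamma> \<tturnstile> \<Delta>)"
| ConjL2: "LKe_rule L [add_mset G \<Gamma> \<tturnstile> \<Delta>] (add_mset (Conj F G) \<Gamma> \<tturnstile> \<Delta>)"
| ConjR: "LKe_rule L [\<Gamma> \<tturnstile> add_mset F \<Delta>, \<Gamma> \<tturnstile> add_mset G \<Delta>] (\<Gamma> \<tturnstile> add_mset (Conj F G) \<Delta>)"
| DisjL: "LKe_rule L [add_mset F \<Gamma> \<tturnstile> \<Delta>, add_mset G \<Gamma> \<tturnstile> \<Delta>] (add_mset (Disj F G) \<Gamma> \<tturnstile> \<Delta>)"
| DisjR1: "LKe_rule L [\<Gamma> \<tturnstile> add_mset F \<Delta>] (\<Gamma> \<tturnstile> add_mset (Disj F G) \<Delta>)"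
| DisjR2: "LKe_rule L [\<Gamma> \<tturnstile> add_mset G \<Delta>] (\<Gamma> \<tturnstile> add_mset (Disj F G) \<Delta>)"
| ImplL: "LKe_rule L [\<Gamma> \<tturnstile> add_mset F \<Delta>, add_mset G \<Pi> \<tturnstile> \<Lambda>]
    (add_mset (Impl F G) (\<Gamma> + \<Pi>) \<tturnstile> \<Delta> + \<Lambda>)"
| ImplR: "LKe_rule L [add_mset F \<Gamma> \<tturnstile> add_mset G \<Delta>] (\<Gamma> \<tturnstile> add_mset (Impl F G) \<Delta>)"
| ForallL: "wf_tm L t \<Longrightarrow>
    LKe_rule L [add_mset (inst F t) \<Gamma> \<tturnstile> \<Delta>] (add_mset (Forall F) \<Gamma> \<tturnstile> \<Delta>)"
| ForallR: "y \<notin> fv_sequent (\<Gamma> \<tturnstile> add_mset (Forall F) \<Delta>) \<Longrightarrow>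
    LKe_rule L [\<Gamma> \<tturnstile> add_mset (inst F (Var y)) \<Delta>] (\<Gamma> \<tturnstile> add_mset (Forall F) \<Delta>)"
| ExistsL: "y \<notin> fv_sequent (add_mset (Exists F) \<Gamma> \<tturnstile> \<Delta>) \<Longrightarrow>
    LKe_rule L [add_mset (inst F (Var y)) \<Gamma> \<tturnstile> \<Delta>] (add_mset (Exists F) \<Gamma> \<tturnstile> \<Delta>)"
| ExistsR: "wf_tm L t \<Longrightarrow>
    LKe_rule L [\<Gamma> \<tturnstile> add_mset (inst F t) \<Delta>] (\<Gamma> \<tturnstile> add_mset (Exists F) \<Delta>)"

text \<open>Derivability from \<open>LK\<^sub>e\<close> over \<open>L\<close>, extended by the inference rules \<open>R\<close>.\<close>

inductive derivable ::
  "('f, 'p) language \<Rightarrow> (('f, 'p) sequent list \<Rightarrow> ('f, 'p) sequent \<Rightarrow> bool)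
    \<Rightarrow> ('f, 'p) sequent \<Rightarrow> bool"
  for L :: "('f, 'p) language" and R :: "('f, 'p) sequent list \<Rightarrow> ('f, 'p) sequent \<Rightarrow> bool" where
  "LKe_rule L ps c \<or> R ps c \<Longrightarrow> wf_sequent L c \<Longrightarrow> (\<And>p. p \<in> set ps \<Longrightarrow> derivable L R p)
    \<Longrightarrow> derivable L R c"


section \<open>Rules for a defined predicate\<close>

text \<open>
  The conjunction of a list of formulas. The empty conjunction stands for truth; the syntax has no
  primitive constant for it, so a valid sentence is used.
\<close>

fun conjs :: "('f, 'p) fm list \<Rightarrow> ('f, 'p) fm" where
  "conjs [] = Forall (Eq (Var 0) (Var 0))"
| "conjs [F] = F"
| "conjs (F # G # Fs) = Conj F (conjs (G # Fs))"

text \<open>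
  \<open>def_fm xs ts As as\<close> is \<open>\<exists>x\<^sub>1 \<dots> x\<^sub>n. a\<^sub>1 = t\<^sub>1 \<and> \<dots> \<and> a\<^sub>r = t\<^sub>r \<and> A\<^sub>1 \<and> \<dots> \<and> A\<^sub>m\<close>.
  Under the \<open>n\<close> quantifiers, the outermost of which binds \<open>x\<^sub>1\<close>, the variable \<open>x\<^sub>k\<close> becomes the
  index \<open>n - k\<close>, whereas the \<open>a\<^sub>i\<close> are lifted: variables \<open>x\<^sub>k\<close> occurring in them are not captured.
\<close>

definition def_fm ::
  "nat list \<Rightarrow> 'f tm list \<Rightarrow> ('f, 'p) fm list \<Rightarrow> 'f tm list \<Rightarrow> ('f, 'p) fm" where
  "def_fm xs ts As as =
    (let n = length xs; \<sigma> = simsub xs (map Var (rev [0..<n]))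
     in (Exists ^^ n)
          (conjs (map2 Eq (map (lift_tm n) as) (map (subst_tm \<sigma>) ts) @ map (subst_fm \<sigma>) As)))"

inductive D_rule ::
  "'p \<Rightarrow> nat list \<Rightarrow> 'f tm list \<Rightarrow> ('f, 'p) fm list
    \<Rightarrow> ('f, 'p) sequent list \<Rightarrow> ('f, 'p) sequent \<Rightarrow> bool"
  for D :: 'p and xs :: "nat list" and ts :: "'f tm list" and As :: "('f, 'p) fm list" where
  D_L: "length as = length ts \<Longrightarrow>
    D_rule D xs ts As [add_mset (def_fm xs ts As as) \<Gamma> \<tturnstile> \<Delta>] (add_mset (Pred D as) \<Gamma> \<tturnstile> \<Delta>)"
| D_R: "length as = length ts \<Longrightarrow>
    D_rule D xs ts As [\<Gamma> \<tturnstile> add_mset (def_fm xs ts As as) \<Delta>] (\<Gamma> \<tturnstile> add_mset (Pred D as) \<Delta>)"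

inductive D_fcs_rule ::
  "('f, 'p) language \<Rightarrow> 'p \<Rightarrow> nat list \<Rightarrow> 'f tm list \<Rightarrow> ('f, 'p) fm list
    \<Rightarrow> ('f, 'p) sequent list \<Rightarrow> ('f, 'p) sequent \<Rightarrow> bool"
  for L :: "('f, 'p) language" and D :: 'p and xs :: "nat list" and ts :: "'f tm list"
    and As :: "('f, 'p) fm list" where
  D_fcs_L: "length as = length ts \<Longrightarrow> length zs = length xs \<Longrightarrow> distinct zs \<Longrightarrow>
    set zs \<inter> fv_sequent (add_mset (Pred D as) \<Gamma> \<tturnstile> \<Delta>) = {} \<Longrightarrow>
    \<sigma> = simsub xs (map Var zs) \<Longrightarrow>
    D_fcs_rule L D xs ts As
      [mset (map2 Eq as (map (subst_tm \<sigma>) ts)) + mset (map (subst_fm \<sigma>) As) + \<Gamma> \<tturnstile> \<Delta>]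
      (add_mset (Pred D as) \<Gamma> \<tturnstile> \<Delta>)"
| D_fcs_R: "length us = length xs \<Longrightarrow> (\<And>u. u \<in> set us \<Longrightarrow> wf_tm L u) \<Longrightarrow>
    \<sigma> = simsub xs us \<Longrightarrow>
    D_fcs_rule L D xs ts As
      (map (\<lambda>A. \<Gamma> \<tturnstile> add_mset (subst_fm \<sigma> A) \<Delta>) As)
      (\<Gamma> \<tturnstile> add_mset (Pred D (map (subst_tm \<sigma>) ts)) \<Delta>)"

text \<open>Provability over the language \<open>L \<union> {D}\<close>, where the arity of \<open>D\<close> is the length of \<open>ts\<close>.\<close>

definition LKe_D_proves ::
  "('f, 'p) language \<Rightarrow> 'p \<Rightarrow> nat list \<Rightarrow> 'f tm list \<Rightarrow> ('f, 'p) fm list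
    \<Rightarrow> ('f, 'p) fm \<Rightarrow> bool" where
  "LKe_D_proves L D xs ts As \<psi> \<longleftrightarrow>
    derivable (add_pred L D (length ts)) (D_rule D xs ts As) ({#} \<tturnstile> {#\<psi>#})"

definition LKe_fcs_D_proves ::
  "('f, 'p) language \<Rightarrow> 'p \<Rightarrow> nat list \<Rightarrow> 'f tm list \<Rightarrow> ('f, 'p) fm list
    \<Rightarrow> ('f, 'p) fm \<Rightarrow> bool" where
  "LKe_fcs_D_proves L D xs ts As \<psi> \<longleftrightarrow>
    derivable (add_pred L D (length ts)) (D_fcs_rule (add_pred L D (length ts)) D xs ts As)
      ({#} \<tturnstile> {#\<psi>#})"

end

theory Submission
  imports Defs
begin

text \<open>
  Each of the two calculi derives the rules of the other, so a derivation in one is translated into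
  the other rule by rule (\<open>derivable_simulation\<close>). Everything rests on the behaviour of the defining
  formula \<open>\<phi>(a\<^sub>1, \<dots>, a\<^sub>r)\<close> in pure \<open>LK\<^sub>e\<close>: stripping its quantifiers turns it into the multiset of
  formulas \<open>a\<^sub>i = t\<^sub>i[x\<setminus>u]\<close>, \<open>A\<^sub>j[x\<setminus>u]\<close> (the list \<open>matrix_inst us as\<close> below). On the left
  the \<open>u\<close> are fresh variables and the formulas may be assumed (\<open>derivable_def_fm_left\<close>); on the
  right they are arbitrary terms and the formulas have to be derived
  (\<open>derivable_def_fm_right\<close>).

  From the rules for \<open>\<phi>\<close> to those with eigenvariables and witnesses: the left rule with
  eigenvariables is the left analysis of \<open>\<phi>\<close> followed by \<open>D_L\<close>. For the right rule, \<open>a\<^sub>i\<close> is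
  \<open>t\<^sub>i[x\<setminus>u]\<close> itself, so the equations required by the right analysis are instances of
  reflexivity, and \<open>D_R\<close> applies.

  Conversely, the rules \<open>D_L\<close> and \<open>D_R\<close> follow by a cut with \<open>\<phi>\<close> once \<open>D(a) \<rightarrow> \<phi>(a)\<close> and
  \<open>\<phi>(a) \<rightarrow> D(a)\<close> are derived. The former assumes the equations and atoms for fresh \<open>\<zeta>\<close> and then uses
  the \<open>\<zeta>\<close> as witnesses. The latter has the equations and atoms for fresh \<open>\<zeta>\<close> available, from which
  the right rule yields \<open>D(t\<^sub>1[x\<setminus>\<zeta>], \<dots>, t\<^sub>r[x\<setminus>\<zeta>])\<close>; the equations and
  substitutivity of equality in \<open>D\<close> lead from there to \<open>D(a)\<close>.
\<close>

section \<open>Substitution\<close>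

lemma subst_tm_cong: "(\<And>v. v \<in> fv_tm t \<Longrightarrow> \<sigma> v = \<tau> v) \<Longrightarrow> subst_tm \<sigma> t = subst_tm \<tau> t"
  by (induction t) auto

lemma subst_tm_comp: "subst_tm \<sigma> (subst_tm \<tau> t) = subst_tm (\<lambda>v. subst_tm \<sigma> (\<tau> v)) t"
  by (induction t) auto

lemma subst_tm_Var [simp]: "subst_tm Var t = t"
  by (induction t) (auto simp: map_idI)

lemma fv_subst_tm: "fv_tm (subst_tm \<sigma> t) = (\<Union>v\<in>fv_tm t. fv_tm (\<sigma> v))"
  by (induction t) auto

lemma wf_subst_tm: "wf_tm L t \<Longrightarrow> (\<And>v. wf_tm L (\<sigma> v)) \<Longrightarrow> wf_tm L (subst_tm \<sigma> t)"
  by (induction t) auto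

lemma finite_fv_tm [simp]: "finite (fv_tm t)"
  by (induction t) auto

lemma fv_lift_tm: "fv_tm (lift_tm k t) = (\<lambda>v. v + k) ` fv_tm t"
  by (auto simp: lift_tm_def fv_subst_tm)

lemma lift_tm_Var [simp]: "lift_tm k (Var v) = Var (v + k)"
  by (simp add: lift_tm_def)

lemma wf_lift_tm: "wf_tm L t \<Longrightarrow> wf_tm L (lift_tm k t)"
  by (simp add: lift_tm_def wf_subst_tm)

lemma lift_tm_lift_tm: "lift_tm k (lift_tm l t) = lift_tm (l + k) t"
  by (simp add: lift_tm_def subst_tm_comp add.assoc)

lemma under_binder_0 [simp]: "under_binder \<sigma> 0 = Var 0"
  and under_binder_Suc [simp]: "under_binder \<sigma> (Suc v) = lift_tm 1 (\<sigma> v)"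
  by (simp_all add: under_binder_def)

lemma subst_under_binder_comp:
  "subst_tm (under_binder \<sigma>) (under_binder \<tau> v) = under_binder (\<lambda>v. subst_tm \<sigma> (\<tau> v)) v"
  by (cases v) (auto simp: lift_tm_def subst_tm_comp)

lemma subst_fm_comp: "subst_fm \<sigma> (subst_fm \<tau> F) = subst_fm (\<lambda>v. subst_tm \<sigma> (\<tau> v)) F"
  by (induction F arbitrary: \<sigma> \<tau>) (auto simp: subst_tm_comp subst_under_binder_comp)

lemma under_binder_cong:
  "(\<And>v. Suc v \<in> V \<Longrightarrow> \<sigma> v = \<tau> v) \<Longrightarrow> v \<in> V \<Longrightarrow> under_binder \<sigma> v = under_binder \<tau> v"
  by (cases v) simp_all

lemma subst_fm_cong: "(\<And>v. v \<in> fv_fm F \<Longrightarrow> \<sigma> v = \<tau> v) \<Longrightarrow> subst_fm \<sigma> F = subst_fm \<tau> F"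
proof (induction F arbitrary: \<sigma> \<tau>)
  case (Forall F)
  have "under_binder \<sigma> v = under_binder \<tau> v" if "v \<in> fv_fm F" for v
    using _ that by (rule under_binder_cong) (simp add: Forall.prems)
  from Forall.IH[OF this] show ?case by simp
next
  case (Exists F)
  have "under_binder \<sigma> v = under_binder \<tau> v" if "v \<in> fv_fm F" for v
    using _ that by (rule under_binder_cong) (simp add: Exists.prems)
  from Exists.IH[OF this] show ?case by simp
next
  case (Conj F G)
  have "subst_fm \<sigma> F = subst_fm \<tau> F" "subst_fm \<sigma> G = subst_fm \<tau> G"
    by (rule Conj.IH, simp add: Conj.prems)+
  then show ?case by simp
next
  case (Disj F G)
  have "subst_fm \<sigma> F = subst_fm \<tau> F" "subst_fm \<sigma> G = subst_fm \<tau> G"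
    by (rule Disj.IH, simp add: Disj.prems)+
  then show ?case by simp
next
  case (Impl F G)
  have "subst_fm \<sigma> F = subst_fm \<tau> F" "subst_fm \<sigma> G = subst_fm \<tau> G"
    by (rule Impl.IH, simp add: Impl.prems)+
  then show ?case by simp
next
  case (Neg F)
  have "subst_fm \<sigma> F = subst_fm \<tau> F"
    by (rule Neg.IH, simp add: Neg.prems)
  then show ?case by simp
qed (auto intro!: subst_tm_cong)

lemma Suc_fv_under_binder:
  "Suc w \<in> fv_tm (under_binder \<sigma> v) \<longleftrightarrow> (\<exists>v'. v = Suc v' \<and> w \<in> fv_tm (\<sigma> v'))"
  by (cases v) (auto simp: fv_lift_tm)

lemma fv_subst_fm: "fv_fm (subst_fm \<sigma> F) = (\<Union>v\<in>fv_fm F. fv_tm (\<sigma> v))"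
  by (induction F arbitrary: \<sigma>) (auto simp: fv_subst_tm Suc_fv_under_binder)

lemma wf_under_binder: "(\<And>v. wf_tm L (\<sigma> v)) \<Longrightarrow> wf_tm L (under_binder \<sigma> v)"
  by (cases v) (auto simp: wf_lift_tm)

lemma wf_subst_fm: "wf_fm L F \<Longrightarrow> (\<And>v. wf_tm L (\<sigma> v)) \<Longrightarrow> wf_fm L (subst_fm \<sigma> F)"
  by (induction F arbitrary: \<sigma>) (auto simp: wf_subst_tm wf_under_binder)

lemma finite_fv_fm [simp]: "finite (fv_fm F)"
proof (induction F)
  case (Forall F)
  then show ?case using finite_vimageI[OF Forall inj_Suc] by (simp add: vimage_def)
next
  case (Exists F)
  then show ?case using finite_vimageI[OF Exists inj_Suc] by (simp add: vimage_def)
qed auto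

lemma fv_inst: "fv_fm (inst F t) \<subseteq> fv_fm (Exists F) \<union> fv_tm t"
  by (auto simp: inst_def fv_subst_fm split: nat.splits)

lemma wf_inst: "wf_fm L F \<Longrightarrow> wf_tm L t \<Longrightarrow> wf_fm L (inst F t)"
  by (auto simp: inst_def intro!: wf_subst_fm split: nat.splits)

lemma simsub_nth:
  assumes "distinct xs" "length us = length xs" "k < length xs"
  shows "simsub xs us (xs ! k) = us ! k"
  using assms by (simp add: simsub_def map_of_zip_nth)

lemma wf_simsub: "(\<And>u. u \<in> set us \<Longrightarrow> wf_tm L u) \<Longrightarrow> wf_tm L (simsub xs us v)"
  by (auto simp: simsub_def split: option.splits dest!: map_of_SomeD set_zip_rightD)


section \<open>Blocks of existential quantifiers\<close>

text \<open>
  \<open>inst_many us\<close> strips a block of quantifiers at once. The outermost quantifier of the block owns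
  the largest index and receives the first term, hence the reversal.
\<close>

definition inst_many :: "'f tm list \<Rightarrow> nat \<Rightarrow> 'f tm" where
  "inst_many us i = (if i < length us then rev us ! i else Var (i - length us))"

lemma inst_many_Nil [simp]: "inst_many [] = Var"
  by (auto simp: inst_many_def)

lemma subst_fm_Var [simp]: "subst_fm Var F = F"
proof -
  have "under_binder Var = (Var :: nat \<Rightarrow> 'a tm)"
    by (auto simp: fun_eq_iff under_binder_def split: nat.splits)
  then show ?thesis by (induction F) (auto simp: map_idI)
qed

lemma inst_many_lift_tm: "length us = n \<Longrightarrow> subst_tm (inst_many us) (lift_tm n t) = t"
  by (simp add: lift_tm_def subst_tm_comp inst_many_def)

lemma subst_Exists_pow:
  "subst_fm \<sigma> ((Exists ^^ n) F) = (Exists ^^ n) (subst_fm ((under_binder ^^ n) \<sigma>) F)"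
  by (induction n arbitrary: \<sigma>) (simp_all add: funpow_swap1[of under_binder])

lemma fv_Exists_pow: "fv_fm ((Exists ^^ n) F) = {v. v + n \<in> fv_fm F}"
  by (induction n) simp_all

lemma wf_Exists_pow [simp]: "wf_fm L ((Exists ^^ n) F) = wf_fm L F"
  by (induction n) simp_all

lemma under_binder_pow:
  "(under_binder ^^ n) \<sigma> i = (if i < n then Var i else lift_tm n (\<sigma> (i - n)))"
proof (induction n arbitrary: i)
  case 0
  then show ?case by (simp add: lift_tm_def)
next
  case (Suc n)
  then show ?case by (cases i) (simp_all add: lift_tm_lift_tm)
qed

text \<open>Instantiating the outermost quantifier first and the rest afterwards is the same as \<open>inst_many\<close>.\<close>

lemma inst_many_Cons:
  "subst_fm (inst_many us) (subst_fm ((under_binder ^^ length us) (case_nat u Var)) F)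
    = subst_fm (inst_many (u # us)) F"
proof -
  have "subst_tm (inst_many us) ((under_binder ^^ length us) (case_nat u Var) i)
      = inst_many (u # us) i" for i
  proof -
    consider "i < length us" | "i = length us" | j where "i = Suc (length us + j)"
      by (metis less_imp_Suc_add nat_neq_iff)
    then show ?thesis
      by cases (simp_all add: under_binder_pow inst_many_lift_tm, simp_all add: inst_many_def nth_append)
  qed
  then show ?thesis by (simp add: subst_fm_comp)
qed


section \<open>Structural rules\<close>

lemma derivable_wf: "derivable L R c \<Longrightarrow> wf_sequent L c"
  by (erule derivable.cases) simp

lemma derivable_LKe:
  "LKe_rule L ps c \<Longrightarrow> wf_sequent L c \<Longrightarrow> (\<And>p. p \<in> set ps \<Longrightarrow> derivable L R p) \<Longrightarrow> derivable L R c"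
  using derivable.intros by blast

lemma derivable_simulation:
  assumes "derivable L R c"
    and "\<And>ps c. R ps c \<Longrightarrow> wf_sequent L c \<Longrightarrow> (\<And>p. p \<in> set ps \<Longrightarrow> derivable L R' p)
      \<Longrightarrow> derivable L R' c"
  shows "derivable L R' c"
  using assms(1)
proof (induction rule: derivable.induct)
  case (1 ps c)
  then show ?case using assms(2) derivable_LKe by blast
qed

lemma derivable_weaken:
  assumes "derivable L R (\<Gamma> \<tturnstile> \<Delta>)" "wf_sequent L (\<Pi> \<tturnstile> \<Lambda>)"
  shows "derivable L R (\<Pi> + \<Gamma> \<tturnstile> \<Lambda> + \<Delta>)"
proof -
  have left: "derivable L R (\<Pi> + \<Gamma> \<tturnstile> \<Delta>)"
    using assms(2)
  proof (induction \<Pi>)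
    case empty
    then show ?case using assms(1) by simp
  next
    case (add F \<Pi>)
    then have "derivable L R (\<Pi> + \<Gamma> \<tturnstile> \<Delta>)" by auto
    with add.prems derivable_wf[OF this] show ?case
      by (auto intro!: derivable_LKe[OF LKe_rule.WeakL])
  qed
  show ?thesis
    using assms(2)
  proof (induction \<Lambda>)
    case empty
    then show ?case using left by simp
  next
    case (add F \<Lambda>)
    then have "derivable L R (\<Pi> + \<Gamma> \<tturnstile> \<Lambda> + \<Delta>)" by auto
    with add.prems derivable_wf[OF this] show ?case
      by (auto intro!: derivable_LKe[OF LKe_rule.WeakR])
  qed
qed

lemma derivable_contract_left:
  "derivable L R (\<Pi> + \<Gamma> \<tturnstile> \<Delta>) \<Longrightarrow> set_mset \<Pi> \<subseteq> set_mset \<Gamma> \<Longrightarrow> derivable L R (\<Gamma> \<tturnstile> \<Delta>)"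
proof (induction \<Pi>)
  case (add F \<Pi>)
  then obtain \<Gamma>' where \<Gamma>: "\<Gamma> = add_mset F \<Gamma>'" by (auto dest: mset_add)
  have "derivable L R (add_mset F (add_mset F (\<Pi> + \<Gamma>')) \<tturnstile> \<Delta>)" using add.prems \<Gamma> by simp
  with derivable_wf[OF this] have "derivable L R (add_mset F (\<Pi> + \<Gamma>') \<tturnstile> \<Delta>)"
    by (auto intro!: derivable_LKe[OF LKe_rule.ContrL])
  then show ?case using add \<Gamma> by simp
qed simp

lemma derivable_contract_right:
  "derivable L R (\<Gamma> \<tturnstile> \<Lambda> + \<Delta>) \<Longrightarrow> set_mset \<Lambda> \<subseteq> set_mset \<Delta> \<Longrightarrow> derivable L R (\<Gamma> \<tturnstile> \<Delta>)"
proof (induction \<Lambda>)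
  case (add F \<Lambda>)
  then obtain \<Delta>' where \<Delta>: "\<Delta> = add_mset F \<Delta>'" by (auto dest: mset_add)
  have "derivable L R (\<Gamma> \<tturnstile> add_mset F (add_mset F (\<Lambda> + \<Delta>')))" using add.prems \<Delta> by simp
  with derivable_wf[OF this] have "derivable L R (\<Gamma> \<tturnstile> add_mset F (\<Lambda> + \<Delta>'))"
    by (auto intro!: derivable_LKe[OF LKe_rule.ContrR])
  then show ?case using add \<Delta> by simp
qed simp

text \<open>
  By weakening and contraction, only the sets of formulas on either side matter. This takes care of
  the multiplicities in the cuts below, whose premises come with different contexts.
\<close>

lemma derivable_mono:
  assumes "derivable L R (\<Gamma> \<tturnstile> \<Delta>)" "set_mset \<Gamma> \<subseteq> set_mset \<Pi>" "set_mset \<Delta> \<subseteq> set_mset \<Lambda>"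
    "wf_sequent L (\<Pi> \<tturnstile> \<Lambda>)"
  shows "derivable L R (\<Pi> \<tturnstile> \<Lambda>)"
proof -
  have "derivable L R (\<Gamma> + \<Pi> \<tturnstile> \<Delta> + \<Lambda>)"
    using derivable_weaken[OF assms(1,4)] by (simp add: add.commute)
  then show ?thesis using assms derivable_contract_left derivable_contract_right by blast
qed

lemma derivable_ax: "F \<in># \<Gamma> \<Longrightarrow> F \<in># \<Delta> \<Longrightarrow> wf_sequent L (\<Gamma> \<tturnstile> \<Delta>) \<Longrightarrow> derivable L R (\<Gamma> \<tturnstile> \<Delta>)"
  by (rule derivable_mono[OF derivable_LKe[OF LKe_rule.Ax[of L F]]]) auto

lemma derivable_cut:
  assumes "derivable L R (\<Gamma> \<tturnstile> add_mset F \<Delta>)" "derivable L R (add_mset F \<Gamma> \<tturnstile> \<Delta>)"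
  shows "derivable L R (\<Gamma> \<tturnstile> \<Delta>)"
proof -
  have "derivable L R (\<Gamma> + \<Gamma> \<tturnstile> \<Delta> + \<Delta>)"
    by (rule derivable_LKe[OF LKe_rule.Cut[of L \<Gamma> F \<Delta> \<Gamma> \<Delta>]])
      (use assms assms[THEN derivable_wf] in auto)
  then show ?thesis by (rule derivable_mono) (use assms[THEN derivable_wf] in auto)
qed

lemma derivable_cut_many:
  assumes "derivable L R (M \<tturnstile> \<Delta>)" "\<And>F. F \<in># M \<Longrightarrow> derivable L R (\<Gamma> \<tturnstile> add_mset F \<Delta>)"
    "wf_sequent L (\<Gamma> \<tturnstile> \<Delta>)"
  shows "derivable L R (\<Gamma> \<tturnstile> \<Delta>)"
proof -
  have "derivable L R (M + \<Gamma> \<tturnstile> \<Delta>)"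
    using assms(1) by (rule derivable_mono) (use assms(3) derivable_wf[OF assms(1)] in auto)
  then show ?thesis using assms(2)
  proof (induction M)
    case (add F M)
    have F: "derivable L R (\<Gamma> \<tturnstile> add_mset F \<Delta>)" using add.prems by simp
    have "derivable L R (M + \<Gamma> \<tturnstile> \<Delta>)"
    proof (rule derivable_cut)
      show "derivable L R (M + \<Gamma> \<tturnstile> add_mset F \<Delta>)"
        by (rule derivable_mono[OF F]) (use derivable_wf[OF add.prems(1)] derivable_wf[OF F] in auto)
      show "derivable L R (add_mset F (M + \<Gamma>) \<tturnstile> \<Delta>)" using add.prems by simp
    qed
    then show ?case using add by simp
  qed simp
qed


section \<open>Equations, conjunctions and quantifier blocks in the calculus\<close>

lemma derivable_refl: "wf_tm L s \<Longrightarrow> wf_sequent L (\<Gamma> \<tturnstile> \<Delta>) \<Longrightarrow> derivable L R (\<Gamma> \<tturnstile> add_mset (Eq s s) \<Delta>)"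
  by (rule derivable_mono[OF derivable_LKe[OF LKe_rule.EqRefl[of L s]]]) auto

text \<open>Symmetry is the instance \<open>s = t, s = s, s = s \<rightarrow> t = s\<close> of the last equality axiom.\<close>

lemma derivable_sym:
  assumes "Eq s t \<in># \<Gamma>" "wf_sequent L (\<Gamma> \<tturnstile> \<Delta>)"
  shows "derivable L R (\<Gamma> \<tturnstile> add_mset (Eq t s) \<Delta>)"
proof -
  have "wf_fm L (Eq s t)" using assms by (simp del: wf_fm.simps)
  then have wf: "wf_tm L s" "wf_tm L t" by simp_all
  show ?thesis
  proof (rule derivable_cut)
    show "derivable L R (\<Gamma> \<tturnstile> add_mset (Eq s s) (add_mset (Eq t s) \<Delta>))"
      using wf assms(2) by (intro derivable_refl) auto
    have "derivable L R ({#Eq s t, Eq s s, Eq s s#} \<tturnstile> {#Eq t s#})"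
      using wf by (intro derivable_LKe[OF LKe_rule.EqEq]) auto
    then show "derivable L R (add_mset (Eq s s) \<Gamma> \<tturnstile> add_mset (Eq t s) \<Delta>)"
      by (rule derivable_mono) (use wf assms in auto)
  qed
qed

lemma wf_conjs [simp]: "wf_fm L (conjs Fs) \<longleftrightarrow> (\<forall>F\<in>set Fs. wf_fm L F)"
  by (induction Fs rule: conjs.induct) auto

lemma fv_conjs: "fv_fm (conjs Fs) = (\<Union>F\<in>set Fs. fv_fm F)"
  by (induction Fs rule: conjs.induct) auto

lemma subst_conjs: "subst_fm \<sigma> (conjs Fs) = conjs (map (subst_fm \<sigma>) Fs)"
  by (induction Fs rule: conjs.induct) auto

text \<open>
  The left rules for conjunction keep only one conjunct, so both are applied and the two copies of
  the conjunction contracted.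
\<close>

lemma derivable_conjs_left:
  "derivable L R (mset Fs + \<Gamma> \<tturnstile> \<Delta>) \<Longrightarrow> derivable L R (add_mset (conjs Fs) \<Gamma> \<tturnstile> \<Delta>)"
proof (induction Fs arbitrary: \<Gamma> rule: conjs.induct)
  case 1
  then show ?case by (rule derivable_mono) (use derivable_wf[OF 1] in auto)
next
  case (2 F)
  then show ?case by simp
next
  case (3 F G Fs)
  let ?C = "Conj F (conjs (G # Fs))"
  have wf: "wf_fm L ?C" "wf_sequent L (\<Gamma> \<tturnstile> \<Delta>)" using derivable_wf[OF "3.prems"] by auto
  have "derivable L R (add_mset (conjs (G # Fs)) (add_mset F \<Gamma>) \<tturnstile> \<Delta>)"
    using "3.prems" by (intro "3.IH") simp
  then have "derivable L R (add_mset ?C (add_mset F \<Gamma>) \<tturnstile> \<Delta>)"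
    using wf by (intro derivable_LKe[OF LKe_rule.ConjL2]) auto
  then have "derivable L R (add_mset F (add_mset ?C \<Gamma>) \<tturnstile> \<Delta>)"
    by (simp add: add_mset_commute)
  then have "derivable L R (add_mset ?C (add_mset ?C \<Gamma>) \<tturnstile> \<Delta>)"
    using wf by (intro derivable_LKe[OF LKe_rule.ConjL1]) auto
  then show ?case by (rule derivable_mono) (use wf in auto)
qed

lemma derivable_conjs_right:
  assumes "\<And>F. F \<in> set Fs \<Longrightarrow> derivable L R (\<Gamma> \<tturnstile> add_mset F \<Delta>)" "wf_sequent L (\<Gamma> \<tturnstile> \<Delta>)"
  shows "derivable L R (\<Gamma> \<tturnstile> add_mset (conjs Fs) \<Delta>)"
  using assms(1)
proof (induction Fs rule: conjs.induct)
  case 1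
  let ?E = "Eq (Var 0) (Var 0)"
  have "derivable L R ({#} \<tturnstile> {#inst ?E (Var 0)#})"
    by (auto simp: inst_def intro!: derivable_refl)
  then have "derivable L R ({#} \<tturnstile> {#Forall ?E#})"
    by (intro derivable_LKe[OF LKe_rule.ForallR[of 0]]) auto
  then show ?case by (rule derivable_mono) (use assms(2) in auto)
next
  case (2 F)
  then show ?case by simp
next
  case (3 F G Fs)
  have "derivable L R (\<Gamma> \<tturnstile> add_mset F \<Delta>)" using "3.prems" by simp
  moreover have "derivable L R (\<Gamma> \<tturnstile> add_mset (conjs (G # Fs)) \<Delta>)"
    using "3.prems" by (intro "3.IH") simp
  ultimately show ?case
    unfolding conjs.simps
    by (intro derivable_LKe[OF LKe_rule.ConjR]) (auto dest: derivable_wf)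
qed

text \<open>
  The eigenvariables are introduced one by one. After instantiating the outer quantifiers, the formula
  has gained the corresponding eigenvariables as free variables; the remaining ones are still fresh
  because all are distinct.
\<close>

lemma derivable_Exists_pow_left:
  assumes "derivable L R (add_mset (subst_fm (inst_many (map Var zs)) F) \<Gamma> \<tturnstile> \<Delta>)"
    and "distinct zs" "wf_fm L F"
    and "set zs \<inter> fv_sequent (add_mset ((Exists ^^ length zs) F) \<Gamma> \<tturnstile> \<Delta>) = {}"
  shows "derivable L R (add_mset ((Exists ^^ length zs) F) \<Gamma> \<tturnstile> \<Delta>)"
  using assms
proof (induction zs arbitrary: F)
  case (Cons z zs)
  let ?G = "subst_fm ((under_binder ^^ length zs) (case_nat (Var z) Var)) F"
  have G: "inst ((Exists ^^ length zs) F) (Var z) = (Exists ^^ length zs) ?G"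
    by (simp add: inst_def subst_Exists_pow)
  have fv: "fv_fm ((Exists ^^ length zs) ?G) \<subseteq> fv_fm ((Exists ^^ length (z # zs)) F) \<union> {z}"
    using fv_inst[of "(Exists ^^ length zs) F" "Var z"] G by simp
  have wf: "wf_sequent L (\<Gamma> \<tturnstile> \<Delta>)" using derivable_wf[OF Cons.prems(1)] by auto
  have "derivable L R (add_mset ((Exists ^^ length zs) ?G) \<Gamma> \<tturnstile> \<Delta>)"
  proof (rule Cons.IH)
    show "derivable L R (add_mset (subst_fm (inst_many (map Var zs)) ?G) \<Gamma> \<tturnstile> \<Delta>)"
      using Cons.prems(1) inst_many_Cons[of "map Var zs" "Var z" F] by simp
    show "distinct zs" using Cons.prems by simp
    show "wf_fm L ?G"
      using wf_inst[of L "(Exists ^^ length zs) F" "Var z"] G Cons.prems by simp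
    show "set zs \<inter> fv_sequent (add_mset ((Exists ^^ length zs) ?G) \<Gamma> \<tturnstile> \<Delta>) = {}"
      using fv Cons.prems(2,4) by auto
  qed
  then have "derivable L R (add_mset (Exists ((Exists ^^ length zs) F)) \<Gamma> \<tturnstile> \<Delta>)"
    using Cons.prems wf by (intro derivable_LKe[OF LKe_rule.ExistsL[of z]]) (auto simp: G)
  then show ?case by simp
qed simp

lemma derivable_Exists_pow_right:
  assumes "derivable L R (\<Gamma> \<tturnstile> add_mset (subst_fm (inst_many us) F) \<Delta>)"
    and "\<And>u. u \<in> set us \<Longrightarrow> wf_tm L u" "wf_fm L F"
  shows "derivable L R (\<Gamma> \<tturnstile> add_mset ((Exists ^^ length us) F) \<Delta>)"
  using assms
proof (induction us arbitrary: F)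
  case (Cons u us)
  let ?G = "subst_fm ((under_binder ^^ length us) (case_nat u Var)) F"
  have G: "inst ((Exists ^^ length us) F) u = (Exists ^^ length us) ?G"
    by (simp add: inst_def subst_Exists_pow)
  have wf: "wf_sequent L (\<Gamma> \<tturnstile> \<Delta>)" using derivable_wf[OF Cons.prems(1)] by auto
  have "derivable L R (\<Gamma> \<tturnstile> add_mset ((Exists ^^ length us) ?G) \<Delta>)"
  proof (rule Cons.IH)
    show "derivable L R (\<Gamma> \<tturnstile> add_mset (subst_fm (inst_many us) ?G) \<Delta>)"
      using Cons.prems(1) inst_many_Cons[of us u F] by simp
    show "wf_fm L ?G"
      using wf_inst[of L "(Exists ^^ length us) F" u] G Cons.prems by simp
  qed (use Cons.prems in auto)
  then have "derivable L R (\<Gamma> \<tturnstile> add_mset (Exists ((Exists ^^ length us) F)) \<Delta>)"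
    using Cons.prems wf by (intro derivable_LKe[OF LKe_rule.ExistsR[of L u]]) (auto simp: G)
  then show ?case by simp
qed simp


section \<open>The defining formula in the calculus\<close>

lemma fresh_variables:
  assumes "finite (S :: nat set)"
  obtains zs where "length zs = n" "distinct zs" "set zs \<inter> S = {}"
proof -
  obtain m where "\<forall>v\<in>S. v < m" using assms by (auto simp: finite_nat_set_iff_bounded)
  then have "length [m..<m + n] = n" "distinct [m..<m + n]" "set [m..<m + n] \<inter> S = {}" by auto
  then show ?thesis using that by blast
qed

text \<open>
  Both calculi live over the language with \<open>D\<close>; that is the language called \<open>L\<close> here.
\<close>

locale existential_definition =
  fixes L :: "('f, 'p) language" and D :: 'p
    and xs :: "nat list" and ts :: "'f tm list" and As :: "('f, 'p) fm list"
  assumes arity_D: "pred_arity L D = Some (length ts)"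
    and distinct_xs: "distinct xs"
    and ts: "\<And>t. t \<in> set ts \<Longrightarrow> wf_tm L t \<and> fv_tm t \<subseteq> set xs"
    and As: "\<And>A. A \<in> set As \<Longrightarrow> wf_fm L A \<and> fv_fm A \<subseteq> set xs"
begin

definition matrix_inst :: "'f tm list \<Rightarrow> 'f tm list \<Rightarrow> ('f, 'p) fm list" where
  "matrix_inst us as =
    map2 Eq as (map (subst_tm (simsub xs us)) ts) @ map (subst_fm (simsub xs us)) As"

abbreviation index_subst :: "nat \<Rightarrow> 'f tm" where
  "index_subst \<equiv> simsub xs (map Var (rev [0..<length xs]))"

definition def_matrix :: "'f tm list \<Rightarrow> ('f, 'p) fm" where
  "def_matrix as =
    conjs (map2 Eq (map (lift_tm (length xs)) as) (map (subst_tm index_subst) ts)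
      @ map (subst_fm index_subst) As)"

lemma def_fm_eq: "def_fm xs ts As as = (Exists ^^ length xs) (def_matrix as)"
  by (simp add: def_fm_def def_matrix_def Let_def)

lemma index_subst_nth: "k < length xs \<Longrightarrow> index_subst (xs ! k) = Var (length xs - Suc k)"
  by (simp add: simsub_nth[OF distinct_xs] rev_nth)

text \<open>
  Since the variables of \<open>ts\<close> and \<open>As\<close> are among \<open>xs\<close>, passing through the bound indices and
  then stripping the quantifiers amounts to substituting for \<open>xs\<close> directly.
\<close>

lemma inst_many_index_subst:
  assumes "length us = length xs" "v \<in> set xs"
  shows "subst_tm (inst_many us) (index_subst v) = simsub xs us v"
proof -
  obtain k where k: "k < length xs" "v = xs ! k" using assms(2) by (auto simp: in_set_conv_nth)
  then have "length xs - Suc k < length us" using assms(1) by simp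
  then show ?thesis
    using k assms(1) by (simp add: index_subst_nth simsub_nth[OF distinct_xs] inst_many_def rev_nth)
qed

lemma subst_def_matrix:
  assumes us: "length us = length xs"
  shows "subst_fm (inst_many us) (def_matrix as) = conjs (matrix_inst us as)"
proof -
  have "subst_tm (inst_many us) (subst_tm index_subst t) = subst_tm (simsub xs us) t"
    if "t \<in> set ts" for t
    using ts[OF that] inst_many_index_subst[OF us]
    by (auto simp: subst_tm_comp intro!: subst_tm_cong)
  moreover have "subst_fm (inst_many us) (subst_fm index_subst A) = subst_fm (simsub xs us) A"
    if "A \<in> set As" for A
    using As[OF that] inst_many_index_subst[OF us]
    by (auto simp: subst_fm_comp intro!: subst_fm_cong)
  ultimately have eqs:
    "map (subst_fm (inst_many us))
        (map2 Eq (map (lift_tm (length xs)) as) (map (subst_tm index_subst) ts)) =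
      (map2 Eq as (map (subst_tm (simsub xs us)) ts) :: ('f, 'p) fm list)"
    "map (subst_fm (inst_many us)) (map (subst_fm index_subst) As) =
      map (subst_fm (simsub xs us)) As"
    using us by (auto intro!: nth_equalityI simp: inst_many_lift_tm)
  show ?thesis
    unfolding def_matrix_def matrix_inst_def subst_conjs map_append eqs ..
qed

lemma in_map2_append_mapE:
  assumes "F \<in> set (map2 f as (map g ts) @ map h As)"
  obtains (left) a t where "a \<in> set as" "t \<in> set ts" "F = f a (g t)"
    | (right) A where "A \<in> set As" "F = h A"
proof -
  from assms consider p where "p \<in> set (zip as (map g ts))" "F = (case p of (a, s) \<Rightarrow> f a s)"
    | A where "A \<in> set As" "F = h A"
    by auto
  then show ?thesis
  proof cases
    case 1
    obtain a s where p: "p = (a, s)" by fastforce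
    have "a \<in> set as" "s \<in> set (map g ts)"
      using 1(1) unfolding p by (blast dest: set_zip_leftD set_zip_rightD)+
    then show ?thesis using 1(2) p left by auto
  qed (rule right)
qed

lemma wf_matrix_inst:
  assumes "\<And>a. a \<in> set as \<Longrightarrow> wf_tm L a" "\<And>u. u \<in> set us \<Longrightarrow> wf_tm L u" "F \<in> set (matrix_inst us as)"
  shows "wf_fm L F"
  using assms(3) unfolding matrix_inst_def
  by (cases rule: in_map2_append_mapE)
    (use assms(1,2) ts As in \<open>auto intro!: wf_subst_tm wf_subst_fm wf_simsub\<close>)

lemma wf_def_matrix:
  assumes "\<And>a. a \<in> set as \<Longrightarrow> wf_tm L a"
  shows "wf_fm L (def_matrix as)"
proof -
  have "wf_tm L (index_subst v)" for v by (rule wf_simsub) auto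
  then show ?thesis
    unfolding def_matrix_def wf_conjs using assms ts As
    by (auto intro!: wf_subst_tm wf_subst_fm wf_lift_tm simp del: set_append
        elim!: in_map2_append_mapE)
qed

lemma fv_def_fm: "fv_fm (def_fm xs ts As as) \<subseteq> (\<Union>a\<in>set as. fv_tm a)"
proof
  fix v
  let ?n = "length xs"
  assume "v \<in> fv_fm (def_fm xs ts As as)"
  then have v: "v + ?n \<in> fv_fm (def_matrix as)"
    by (simp add: def_fm_eq fv_Exists_pow)
  have bound: "fv_tm (index_subst w) \<subseteq> {..<?n}" if "w \<in> set xs" for w
    using that by (auto simp: in_set_conv_nth index_subst_nth)
  from v obtain F where "v + ?n \<in> fv_fm F"
    and "F \<in> set (map2 Eq (map (lift_tm ?n) as) (map (subst_tm index_subst) ts)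
      @ map (subst_fm index_subst) As)"
    unfolding def_matrix_def fv_conjs by blast
  from this(2,1) show "v \<in> (\<Union>a\<in>set as. fv_tm a)"
  proof (cases rule: in_map2_append_mapE)
    case (left a t)
    have "fv_tm (subst_tm index_subst t) \<subseteq> {..<?n}"
      using ts[OF left(2)] bound unfolding fv_subst_tm by blast
    with left \<open>v + ?n \<in> fv_fm F\<close> show ?thesis by (fastforce simp: fv_lift_tm)
  next
    case (right A)
    have "fv_fm F \<subseteq> {..<?n}"
      using As[OF right(1)] bound unfolding right(2) fv_subst_fm by blast
    with \<open>v + ?n \<in> fv_fm F\<close> show ?thesis by auto
  qed
qed

lemma derivable_def_fm_left:
  assumes "derivable L R (mset (matrix_inst (map Var zs) as) + \<Gamma> \<tturnstile> \<Delta>)"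
    and zs: "length zs = length xs" "distinct zs"
    and fresh: "set zs \<inter> fv_sequent (add_mset (Pred D as) \<Gamma> \<tturnstile> \<Delta>) = {}"
    and as: "\<And>a. a \<in> set as \<Longrightarrow> wf_tm L a"
  shows "derivable L R (add_mset (def_fm xs ts As as) \<Gamma> \<tturnstile> \<Delta>)"
proof -
  have "derivable L R (add_mset (subst_fm (inst_many (map Var zs)) (def_matrix as)) \<Gamma> \<tturnstile> \<Delta>)"
    using derivable_conjs_left[OF assms(1)] zs by (simp add: subst_def_matrix)
  moreover have "fv_sequent (add_mset (def_fm xs ts As as) \<Gamma> \<tturnstile> \<Delta>)
      \<subseteq> fv_sequent (add_mset (Pred D as) \<Gamma> \<tturnstile> \<Delta>)"
    using fv_def_fm[of as] by auto
  then have "set zs \<inter> fv_sequent (add_mset ((Exists ^^ length zs) (def_matrix as)) \<Gamma> \<tturnstile> \<Delta>) = {}"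
    using fresh unfolding zs(1) def_fm_eq by blast
  ultimately have "derivable L R (add_mset ((Exists ^^ length zs) (def_matrix as)) \<Gamma> \<tturnstile> \<Delta>)"
    by (intro derivable_Exists_pow_left zs(2) wf_def_matrix as)
  then show ?thesis unfolding zs(1) def_fm_eq .
qed

lemma derivable_def_fm_right:
  assumes "\<And>F. F \<in> set (matrix_inst us as) \<Longrightarrow> derivable L R (\<Gamma> \<tturnstile> add_mset F \<Delta>)"
    and us: "length us = length xs" "\<And>u. u \<in> set us \<Longrightarrow> wf_tm L u"
    and as: "\<And>a. a \<in> set as \<Longrightarrow> wf_tm L a"
    and wf: "wf_sequent L (\<Gamma> \<tturnstile> \<Delta>)"
  shows "derivable L R (\<Gamma> \<tturnstile> add_mset (def_fm xs ts As as) \<Delta>)"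
proof -
  have "derivable L R (\<Gamma> \<tturnstile> add_mset (subst_fm (inst_many us) (def_matrix as)) \<Delta>)"
    unfolding subst_def_matrix[OF us(1)] by (rule derivable_conjs_right[OF assms(1) wf])
  then have "derivable L R (\<Gamma> \<tturnstile> add_mset ((Exists ^^ length us) (def_matrix as)) \<Delta>)"
    by (intro derivable_Exists_pow_right us(2) wf_def_matrix as)
  then show ?thesis unfolding us(1) def_fm_eq .
qed


section \<open>The two calculi derive each other's rules\<close>

lemma derivable_D_fcs_rule:
  assumes "D_fcs_rule L D xs ts As ps c" "wf_sequent L c"
    and "\<And>p. p \<in> set ps \<Longrightarrow> derivable L (D_rule D xs ts As) p"
  shows "derivable L (D_rule D xs ts As) c"
  using assms(1)
proof cases
  case (D_fcs_L as zs \<Gamma> \<Delta> \<sigma>)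
  have "derivable L (D_rule D xs ts As) (mset (matrix_inst (map Var zs) as) + \<Gamma> \<tturnstile> \<Delta>)"
    using assms(3) D_fcs_L by (simp add: matrix_inst_def)
  then have "derivable L (D_rule D xs ts As) (add_mset (def_fm xs ts As as) \<Gamma> \<tturnstile> \<Delta>)"
    using D_fcs_L assms(2) by (intro derivable_def_fm_left) auto
  then show ?thesis
    using D_fcs_L assms(2) D_rule.D_L[of as ts D xs As \<Gamma> \<Delta>]
    by (intro derivable.intros[where c = c]) auto
next
  case (D_fcs_R us \<sigma> \<Gamma> \<Delta>)
  let ?as = "map (subst_tm \<sigma>) ts"
  have wf: "wf_sequent L (\<Gamma> \<tturnstile> \<Delta>)" "\<And>a. a \<in> set ?as \<Longrightarrow> wf_tm L a"
    using assms(2) D_fcs_R by auto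
  have "derivable L (D_rule D xs ts As) (\<Gamma> \<tturnstile> add_mset F \<Delta>)" if F: "F \<in> set (matrix_inst us ?as)" for F
  proof -
    consider t where "t \<in> set ts" "F = Eq (subst_tm \<sigma> t) (subst_tm \<sigma> t)"
      | A where "A \<in> set As" "F = subst_fm \<sigma> A"
      using F D_fcs_R by (auto simp: matrix_inst_def zip_same_conv_map)
    then show ?thesis
    proof cases
      case 1
      then show ?thesis using wf by (auto intro!: derivable_refl)
    next
      case 2
      then show ?thesis using assms(3) D_fcs_R by auto
    qed
  qed
  then have "derivable L (D_rule D xs ts As) (\<Gamma> \<tturnstile> add_mset (def_fm xs ts As ?as) \<Delta>)"
    using D_fcs_R wf by (intro derivable_def_fm_right[of us]) auto
  then show ?thesis
    using D_fcs_R assms(2) D_rule.D_R[of ?as ts D xs As \<Gamma> \<Delta>]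
    by (intro derivable.intros[where c = c]) auto
qed

text \<open>
  The variables \<open>\<zeta>\<close> serve twice: as eigenvariables of the rule for \<open>D\<close> and as witnesses for the
  quantifiers of \<open>\<phi>\<close>, so that every formula to be derived is literally among the assumptions.
\<close>

lemma fcs_defined_imp_def_fm:
  assumes as: "length as = length ts" "\<And>a. a \<in> set as \<Longrightarrow> wf_tm L a"
  shows "derivable L (D_fcs_rule L D xs ts As) ({#Pred D as#} \<tturnstile> {#def_fm xs ts As as#})"
proof -
  obtain zs where zs: "length zs = length xs" "distinct zs"
    and fresh: "set zs \<inter> fv_sequent ({#Pred D as#} \<tturnstile> {#def_fm xs ts As as#}) = {}"
    by (rule fresh_variables[of "fv_sequent ({#Pred D as#} \<tturnstile> {#def_fm xs ts As as#})"]) auto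
  let ?M = "matrix_inst (map Var zs) as"
  have wf: "wf_fm L F" if "F \<in> set ?M" for F
    by (rule wf_matrix_inst[OF as(2) _ that]) auto
  have "derivable L (D_fcs_rule L D xs ts As) (mset ?M \<tturnstile> {#def_fm xs ts As as#})"
    using zs as(2) by (intro derivable_def_fm_right[of "map Var zs"]) (auto simp: wf intro: derivable_ax)
  moreover have "wf_sequent L ({#Pred D as#} \<tturnstile> {#def_fm xs ts As as#})"
    using as arity_D wf_def_matrix[OF as(2)] by (simp add: def_fm_eq)
  ultimately show ?thesis
    using D_fcs_rule.D_fcs_L[OF as(1) zs fresh refl, of L As]
    by (intro derivable.intros[where c = "_ \<tturnstile> _"]) (auto simp: matrix_inst_def)
qed

text \<open>
  The right rule yields \<open>D\<close> only for arguments of the form \<open>t\<^sub>i[x\<setminus>\<zeta>]\<close>; the equations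
  contained in \<open>\<phi>(a)\<close> are what carries \<open>D\<close> over to \<open>a\<close>.
\<close>

lemma fcs_def_fm_imp_defined:
  assumes as: "length as = length ts" "\<And>a. a \<in> set as \<Longrightarrow> wf_tm L a"
  shows "derivable L (D_fcs_rule L D xs ts As) ({#def_fm xs ts As as#} \<tturnstile> {#Pred D as#})"
proof -
  let ?R = "D_fcs_rule L D xs ts As"
  obtain zs where zs: "length zs = length xs" "distinct zs"
    and fresh: "set zs \<inter> fv_sequent ({#Pred D as#} \<tturnstile> {#Pred D as#}) = {}"
    by (rule fresh_variables[of "fv_sequent ({#Pred D as#} \<tturnstile> {#Pred D as#})"]) auto
  let ?\<sigma> = "simsub xs (map Var zs)"
  let ?ss = "map (subst_tm ?\<sigma>) ts" and ?M = "matrix_inst (map Var zs) as"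
  have wf_M: "wf_fm L F" if "F \<in> set ?M" for F
    by (rule wf_matrix_inst[OF as(2) _ that]) auto
  have wf_as: "wf_fm L (Pred D as)" using as arity_D by simp
  have wf_ss: "wf_tm L s" if "s \<in> set ?ss" for s
    using that ts by (auto intro!: wf_subst_tm wf_simsub)
  have defined: "derivable L ?R (mset ?M \<tturnstile> add_mset (Pred D ?ss) {#Pred D as#})"
  proof (rule derivable.intros[OF disjI2])
    show "?R (map (\<lambda>A. mset ?M \<tturnstile> add_mset (subst_fm ?\<sigma> A) {#Pred D as#}) As)
        (mset ?M \<tturnstile> add_mset (Pred D ?ss) {#Pred D as#})"
      using zs by (intro D_fcs_rule.D_fcs_R[of "map Var zs"]) auto
    show "wf_sequent L (mset ?M \<tturnstile> add_mset (Pred D ?ss) {#Pred D as#})"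
      using wf_M wf_as wf_ss arity_D by auto
    fix p
    assume "p \<in> set (map (\<lambda>A. mset ?M \<tturnstile> add_mset (subst_fm ?\<sigma> A) {#Pred D as#}) As)"
    then obtain A where A: "A \<in> set As" "p = (mset ?M \<tturnstile> add_mset (subst_fm ?\<sigma> A) {#Pred D as#})"
      by auto
    then have "subst_fm ?\<sigma> A \<in> set ?M" by (simp add: matrix_inst_def)
    then show "derivable L ?R p"
      unfolding A(2) by (intro derivable_ax[of "subst_fm ?\<sigma> A"]) (use wf_M wf_as in auto)
  qed
  have wf_zip: "wf_tm L s" "wf_tm L a" if "(s, a) \<in> set (zip ?ss as)" for s a
    using wf_ss[OF set_zip_leftD[OF that]] as(2)[OF set_zip_rightD[OF that]] .
  \<comment> \<open>Substitutivity takes the equations in the direction opposite to that of the definition.\<close>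
  have "derivable L ?R (mset (map2 Eq ?ss as) + {#Pred D ?ss#} \<tturnstile> {#Pred D as#})"
    using as wf_ss wf_zip arity_D by (intro derivable_LKe[OF LKe_rule.EqPred]) auto
  then have "derivable L ?R (mset ?M \<tturnstile> {#Pred D as#})"
  proof (rule derivable_cut_many)
    fix F assume "F \<in># mset (map2 Eq ?ss as) + {#Pred D ?ss#}"
    then consider "F = Pred D ?ss" | s a where "F = Eq s a" "(s, a) \<in> set (zip ?ss as)" by auto
    then show "derivable L ?R (mset ?M \<tturnstile> add_mset F {#Pred D as#})"
    proof cases
      case 1
      then show ?thesis using defined by simp
    next
      case 2
      then have "Eq a s \<in> set ?M" by (force simp: matrix_inst_def in_set_zip)
      then show ?thesis
        unfolding 2(1) by (intro derivable_sym) (use wf_M wf_as in auto)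
    qed
  qed (use wf_M wf_as in auto)
  then show ?thesis using zs fresh as(2) by (intro derivable_def_fm_left[of _ zs]) auto
qed

lemma derivable_D_rule:
  assumes "D_rule D xs ts As ps c" "wf_sequent L c"
    and "\<And>p. p \<in> set ps \<Longrightarrow> derivable L (D_fcs_rule L D xs ts As) p"
  shows "derivable L (D_fcs_rule L D xs ts As) c"
  using assms(1)
proof cases
  case (D_L as \<Gamma> \<Delta>)
  have p: "derivable L (D_fcs_rule L D xs ts As) (add_mset (def_fm xs ts As as) \<Gamma> \<tturnstile> \<Delta>)"
    using assms(3) D_L by simp
  have d: "derivable L (D_fcs_rule L D xs ts As) ({#Pred D as#} \<tturnstile> {#def_fm xs ts As as#})"
    using assms(2) D_L by (intro fcs_defined_imp_def_fm) auto
  show ?thesis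
    unfolding D_L
    by (rule derivable_cut[OF derivable_mono[OF d] derivable_mono[OF p]])
      (use derivable_wf[OF p] derivable_wf[OF d] in auto)
next
  case (D_R as \<Gamma> \<Delta>)
  have p: "derivable L (D_fcs_rule L D xs ts As) (\<Gamma> \<tturnstile> add_mset (def_fm xs ts As as) \<Delta>)"
    using assms(3) D_R by simp
  have d: "derivable L (D_fcs_rule L D xs ts As) ({#def_fm xs ts As as#} \<tturnstile> {#Pred D as#})"
    using assms(2) D_R by (intro fcs_def_fm_imp_defined) auto
  show ?thesis
    unfolding D_R
    by (rule derivable_cut[OF derivable_mono[OF p] derivable_mono[OF d]])
      (use derivable_wf[OF p] derivable_wf[OF d] in auto)
qed

lemma derivable_fcs_iff:
  "derivable L (D_fcs_rule L D xs ts As) c \<longleftrightarrow> derivable L (D_rule D xs ts As) c"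
  using derivable_D_fcs_rule derivable_D_rule by (auto elim!: derivable_simulation)

end


section \<open>Passing to the language with the new predicate\<close>

lemma wf_tm_add_pred: "wf_tm (add_pred L D r) t = wf_tm L t"
  by (induction t) (auto simp: add_pred_def)

lemma wf_fm_add_pred: "pred_arity L D = None \<Longrightarrow> wf_fm L F \<Longrightarrow> wf_fm (add_pred L D r) F"
  by (induction F) (auto simp: wf_tm_add_pred, auto simp: add_pred_def)

theorem corollary3p5:
  fixes L :: "('f, 'p) language" and D :: 'p and r :: nat
    and xs :: "nat list" and ts :: "'f tm list" and As :: "('f, 'p) fm list"
    and \<psi> :: "('f, 'p) fm"
  assumes "pred_arity L D = None"
    and "length ts = r"
    and "distinct xs"
    and "\<And>t. t \<in> set ts \<Longrightarrow> wf_tm L t \<and> fv_tm t \<subseteq> set xs"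
    and "\<And>A. A \<in> set As \<Longrightarrow> is_atom A \<and> wf_fm L A \<and> fv_fm A \<subseteq> set xs"
    and "wf_fm (add_pred L D r) \<psi>"
  shows "LKe_fcs_D_proves L D xs ts As \<psi> \<longleftrightarrow> LKe_D_proves L D xs ts As \<psi>"
proof -
  interpret existential_definition "add_pred L D (length ts)" D xs ts As
  proof
    show "pred_arity (add_pred L D (length ts)) D = Some (length ts)" by (simp add: add_pred_def)
    show "distinct xs" by (rule assms)
    show "wf_tm (add_pred L D (length ts)) t \<and> fv_tm t \<subseteq> set xs" if "t \<in> set ts" for t
      using assms(4)[OF that] by (simp add: wf_tm_add_pred)
    show "wf_fm (add_pred L D (length ts)) A \<and> fv_fm A \<subseteq> set xs" if "A \<in> set As" for A
      using assms(5)[OF that] wf_fm_add_pred[OF assms(1)] by simp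
  qed
  show ?thesis
    unfolding LKe_fcs_D_proves_def LKe_D_proves_def by (rule derivable_fcs_iff)
qed

end
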